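(* Let $G$ be a finite simple connected graph with $n$ vertices and $m$ edges. Then $$F(G^{-++})=n(n-1)^3+\xi_4(G)+3\,\mathrm{ReZG}_3(G).$$
   Context: For a finite simple graph $H$ with vertex set $V(H)$ and edge set $E(H)$, $d_H(v)$ denotes the degree of the vertex $v$ in $H$. The F-index of $H$ is $F(H)=\sum_{v\in V(H)} d_H(v)^3$. Further, $\xi_4(H)=\sum_{v\in V(H)} d_H(v)^4=\sum_{uv\in E(H)}[d_H(u)^3+d_H(v)^3]$ and $\mathrm{ReZG}_3(H)=\sum_{uv\in E(H)} d_H(u)d_H(v)[d_H(u)+d_H(v)]$. For $x,y,z\in\{+,-\}$, the total transformation graph $G^{xyz}$ is the simple graph with vertex set $V(G)\cup E(G)$ (disjoint union) in which two distinct elements $u,v$ are adjacent if and only if one of the following holds: (i) $u,v\in V(G)$, and $u,v$ are adjacent in $G$ if $x=+$, respectively not adjacent in $G$ if $x=-$; (ii) $u,v\in E(G)$, and $u,v$ are adjacent in $G$ (share an endpoint) if $y=+$, respectively not adjacent in $G$ if $y=-$; (iii) one of them is a vertex of $G$ and the other is an edge of $G$, and they are incident in $G$ if $z=+$, respectively not incident in $G$ if $z=-$. *)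

theory Defs
  imports Main
begin

text \<open>Undirected graphs; an edge joining \<open>u\<close> and \<open>v\<close> is the set \<open>{u, v}\<close>.\<close>

record 'a ugraph =
  verts :: "'a set"
  edges :: "'a set set"

definition finite_simple_graph :: "'a ugraph \<Rightarrow> bool" where
  "finite_simple_graph G \<longleftrightarrow>
     finite (verts G) \<and> (\<forall>e\<in>edges G. e \<subseteq> verts G \<and> card e = 2)"

definition adjacent :: "'a ugraph \<Rightarrow> 'a \<Rightarrow> 'a \<Rightarrow> bool" where
  "adjacent G u v \<longleftrightarrow> {u, v} \<in> edges G"

text \<open>The graph without vertices is not regarded as connected.\<close>

definition connected_graph :: "'a ugraph \<Rightarrow> bool" where
  "connected_graph G \<longleftrightarrow> verts G \<noteq> {} \<and>
     (\<forall>u\<in>verts G. \<forall>v\<in>verts G. (adjacent G)\<^sup>*\<^sup>* u v)"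

definition degree :: "'a ugraph \<Rightarrow> 'a \<Rightarrow> nat" where
  "degree G v = card {e \<in> edges G. v \<in> e}"

definition F_index :: "'a ugraph \<Rightarrow> nat" where
  "F_index G = (\<Sum>v\<in>verts G. degree G v ^ 3)"

definition xi4 :: "'a ugraph \<Rightarrow> nat" where
  "xi4 G = (\<Sum>v\<in>verts G. degree G v ^ 4)"

text \<open>For an edge \<open>e = {u, v}\<close> of a simple graph, the inner product and sum are
  \<open>d(u) d(v)\<close> and \<open>d(u) + d(v)\<close>.\<close>

definition ReZG3 :: "'a ugraph \<Rightarrow> nat" where
  "ReZG3 G = (\<Sum>e\<in>edges G. (\<Prod>v\<in>e. degree G v) * (\<Sum>v\<in>e. degree G v))"

datatype sign = Plus | Minus

fun signed :: "sign \<Rightarrow> bool \<Rightarrow> bool" where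
  "signed Plus P = P"
| "signed Minus P = (\<not> P)"

text \<open>The adjacency condition for two distinct elements of the disjoint union of
  the vertex set (\<open>Inl\<close>) and the edge set (\<open>Inr\<close>).\<close>

fun transformation_adj ::
  "sign \<Rightarrow> sign \<Rightarrow> sign \<Rightarrow> 'a ugraph \<Rightarrow> 'a + 'a set \<Rightarrow> 'a + 'a set \<Rightarrow> bool" where
  "transformation_adj x y z G (Inl u) (Inl v) = signed x (adjacent G u v)"
| "transformation_adj x y z G (Inr e) (Inr f) = signed y (e \<inter> f \<noteq> {})"
| "transformation_adj x y z G (Inl v) (Inr e) = signed z (v \<in> e)"
| "transformation_adj x y z G (Inr e) (Inl v) = signed z (v \<in> e)"

definition total_transformation ::
  "sign \<Rightarrow> sign \<Rightarrow> sign \<Rightarrow> 'a ugraph \<Rightarrow> ('a + 'a set) ugraph" where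
  "total_transformation x y z G =
     \<lparr>verts = verts G <+> edges G,
      edges = {{p, q} | p q. p \<in> verts G <+> edges G \<and> q \<in> verts G <+> edges G \<and>
                 p \<noteq> q \<and> transformation_adj x y z G p q}\<rparr>"

lemma finite_simple_graph_total_transformation:
  assumes "finite_simple_graph G"
  shows "finite_simple_graph (total_transformation x y z G)"
proof -
  have "finite (edges G)"
    using assms by (auto simp: finite_simple_graph_def intro: finite_subset[of _ "Pow (verts G)"])
  then have "finite (verts (total_transformation x y z G))"
    using assms by (simp add: finite_simple_graph_def total_transformation_def)
  moreover have "e \<subseteq> verts (total_transformation x y z G) \<and> card e = 2"
    if e: "e \<in> edges (total_transformation x y z G)" for e
  proof -
    obtain p q where "e = {p, q}" "p \<in> verts G <+> edges G" "q \<in> verts G <+> edges G" "p \<noteq> q"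
      using e unfolding total_transformation_def ugraph.simps by blast
    then show ?thesis
      by (simp add: total_transformation_def)
  qed
  ultimately show ?thesis
    unfolding finite_simple_graph_def by blast
qed

lemma xi4_eq_sum_edges:
  assumes "finite_simple_graph G"
  shows "xi4 G = (\<Sum>e\<in>edges G. \<Sum>v\<in>e. degree G v ^ 3)"
proof -
  have fin: "finite (verts G)" and sub: "\<And>e. e \<in> edges G \<Longrightarrow> e \<subseteq> verts G"
    using assms by (auto simp: finite_simple_graph_def)
  have finE: "finite (edges G)"
    using fin sub by (auto intro: finite_subset[of _ "Pow (verts G)"])
  have "(\<Sum>e\<in>edges G. \<Sum>v\<in>e. degree G v ^ 3)
      = (\<Sum>e\<in>edges G. \<Sum>v\<in>{v \<in> verts G. v \<in> e}. degree G v ^ 3)"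
    using sub by (intro sum.cong refl) auto
  also have "\<dots> = (\<Sum>v\<in>verts G. \<Sum>e\<in>{e \<in> edges G. v \<in> e}. degree G v ^ 3)"
    using sum.swap_restrict[OF finE fin, of "\<lambda>e v. degree G v ^ 3" "\<lambda>e v. v \<in> e"] by simp
  also have "\<dots> = xi4 G"
    by (simp add: xi4_def degree_def numeral_eq_Suc)
  finally show ?thesis by simp
qed

end

theory Submission
  imports Defs
begin

text \<open>In \<open>G\<^sup>-\<^sup>+\<^sup>+\<close> a vertex of \<open>G\<close> loses its neighbours but gains equally many incident
  edges, so its degree is \<open>n - 1\<close>, whereas an edge \<open>{u, v}\<close> has its 2 endpoints and
  \<open>d(u) + d(v) - 2\<close> adjacent edges as neighbours, so its degree is \<open>d(u) + d(v)\<close>.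
  The claim follows from \<open>(a + b)\<^sup>3 = a\<^sup>3 + b\<^sup>3 + 3ab(a + b)\<close>, summed over the edges.\<close>

lemma finite_edges:
  assumes "finite_simple_graph G"
  shows "finite (edges G)"
  using assms by (auto simp: finite_simple_graph_def intro: finite_subset[of _ "Pow (verts G)"])

lemma adjacent_distinct:
  assumes "finite_simple_graph G" "adjacent G u v"
  shows "u \<noteq> v"
proof -
  have "card {u, v} = 2"
    using assms by (simp add: finite_simple_graph_def adjacent_def)
  then show ?thesis by (cases "u = v") simp_all
qed

lemma adjacent_in_verts:
  assumes "finite_simple_graph G" "adjacent G u v"
  shows "u \<in> verts G" "v \<in> verts G"
  using assms by (auto simp: finite_simple_graph_def adjacent_def)

lemma edgeE:
  assumes "finite_simple_graph G" "e \<in> edges G"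
  obtains u v where "e = {u, v}" "u \<noteq> v" "u \<in> verts G" "v \<in> verts G"
proof -
  have "card e = 2" "e \<subseteq> verts G"
    using assms by (auto simp: finite_simple_graph_def)
  then show ?thesis by (auto simp: card_2_iff intro: that)
qed

text \<open>Pairing a neighbour \<open>u\<close> with the edge \<open>{v, u}\<close> is a bijection.
  It serves twice: in the transformed graph it reduces degrees to neighbourhoods, and in
  \<open>G\<close> it matches the neighbours of a vertex with its incident edges.\<close>

lemma degree_eq_card_neighbours:
  assumes G: "finite_simple_graph G"
  shows "degree G v = card {u. adjacent G v u}"
proof -
  have "{e \<in> edges G. v \<in> e} = (\<lambda>u. {v, u}) ` {u. adjacent G v u}"
  proof (intro equalityI subsetI)
    fix e assume e: "e \<in> {e \<in> edges G. v \<in> e}"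
    then obtain a b where "e = {a, b}"
      using edgeE[OF G] by (metis mem_Collect_eq)
    with e have "e = {v, b} \<or> e = {v, a}" by auto
    with e show "e \<in> (\<lambda>u. {v, u}) ` {u. adjacent G v u}"
      by (auto simp: adjacent_def)
  qed (auto simp: adjacent_def)
  moreover have "inj_on (\<lambda>u. {v, u}) {u. adjacent G v u}"
    by (auto simp: inj_on_def doubleton_eq_iff)
  ultimately show ?thesis
    by (simp add: degree_def card_image)
qed

lemma transformation_adj_commute:
  "transformation_adj x y z G p q \<longleftrightarrow> transformation_adj x y z G q p"
  by (cases p; cases q; cases x; cases y) (auto simp: adjacent_def insert_commute)

text \<open>An unordered pair \<open>{p, q}\<close> may have been generated in either order, so
  symmetry of \<open>transformation_adj\<close> is what makes the condition on the given order
  sufficient and necessary.\<close>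

lemma adjacent_total_transformation:
  "adjacent (total_transformation x y z G) p q \<longleftrightarrow>
     p \<in> verts G <+> edges G \<and> q \<in> verts G <+> edges G \<and> p \<noteq> q \<and> transformation_adj x y z G p q"
  unfolding adjacent_def total_transformation_def ugraph.simps mem_Collect_eq doubleton_eq_iff
  using transformation_adj_commute[of x y z G p q] by blast

lemma card_Inl_Un_Inr:
  assumes "finite A" "finite B"
  shows "card (Inl ` A \<union> Inr ` B) = card A + card B"
  using card_Plus[OF assms] by (simp add: Plus_def)

lemma degree_transformation_vertex:
  assumes G: "finite_simple_graph G" and v: "v \<in> verts G"
  shows "degree (total_transformation Minus Plus Plus G) (Inl v) = card (verts G) - 1"
proof -
  let ?N = "{u. adjacent G v u}" and ?M = "{e \<in> edges G. v \<in> e}"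
  have fin: "finite (verts G)"
    using G by (simp add: finite_simple_graph_def)
  have N: "?N \<subseteq> verts G - {v}"
    using adjacent_distinct[OF G] adjacent_in_verts[OF G] by blast
  have nbrs: "{q. adjacent (total_transformation Minus Plus Plus G) (Inl v) q}
      = Inl ` (verts G - {v} - ?N) \<union> Inr ` ?M" (is "?L = ?R")
  proof (rule set_eqI)
    show "q \<in> ?L \<longleftrightarrow> q \<in> ?R" for q
      using v by (cases q) (auto simp: adjacent_total_transformation)
  qed
  have "degree (total_transformation Minus Plus Plus G) (Inl v)
      = card (verts G - {v} - ?N) + card ?M"
    using fin finite_edges[OF G]
    by (simp add: degree_eq_card_neighbours finite_simple_graph_total_transformation G nbrs
        card_Inl_Un_Inr)
  \<comment> \<open>The gained edges are as many as the lost neighbours; since \<open>?N\<close>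
    lies inside \<open>verts G - {v}\<close>, the two counts cancel exactly.\<close>
  also have "card ?M = card ?N"
    using degree_eq_card_neighbours[OF G] by (simp add: degree_def)
  also have "card (verts G - {v} - ?N) + card ?N = card (verts G - {v})"
    using fin N by (metis card_Diff_subset card_mono finite_Diff finite_subset le_add_diff_inverse2)
  finally show ?thesis using v by simp
qed

lemma degree_transformation_edge:
  assumes G: "finite_simple_graph G" and e: "e \<in> edges G" "e = {u, v}"
  shows "degree (total_transformation Minus Plus Plus G) (Inr e) = degree G u + degree G v"
proof -
  let ?A = "{f \<in> edges G. u \<in> f}" and ?B = "{f \<in> edges G. v \<in> f}"
  let ?K = "{f \<in> edges G. f \<noteq> e \<and> e \<inter> f \<noteq> {}}"
  have uv: "u \<noteq> v"
    using adjacent_distinct[OF G] e by (auto simp: adjacent_def)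
  have sub: "e \<subseteq> verts G"
    using G e by (auto simp: finite_simple_graph_def)
  have fin: "finite ?A" "finite ?B" "finite ?K"
    using finite_edges[OF G] by auto
  \<comment> \<open>There are no parallel edges: a two-element set containing the distinct vertices
    \<open>u\<close> and \<open>v\<close> must be \<open>{u, v}\<close>.\<close>
  have "?A \<inter> ?B = {e}"
  proof (intro equalityI subsetI)
    fix f assume f: "f \<in> ?A \<inter> ?B"
    then obtain a b where "f = {a, b}"
      using edgeE[OF G] by (metis IntD1 mem_Collect_eq)
    with f uv have "f = {u, v}" by auto
    with e show "f \<in> {e}" by simp
  qed (use e in auto)
  moreover have "?A \<union> ?B = insert e ?K"
    using e by auto
  \<comment> \<open>Inclusion-exclusion: \<open>e\<close> is counted once at each endpoint but is
    absent from \<open>?K\<close>, hence the 2.\<close>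
  ultimately have count: "card ?A + card ?B = card ?K + 2"
    using card_Un_Int[OF fin(1,2)] fin(3) by simp
  \<comment> \<open>Both endpoints of \<open>e\<close> lie in \<open>verts G\<close>, so the vertex
    part is all of \<open>e\<close>; the edge part leaves out \<open>e\<close> because adjacency
    requires distinct elements.\<close>
  have nbrs: "{q. adjacent (total_transformation Minus Plus Plus G) (Inr e) q}
      = Inl ` e \<union> Inr ` ?K" (is "?L = ?R")
  proof (rule set_eqI)
    show "q \<in> ?L \<longleftrightarrow> q \<in> ?R" for q
      using e(1) sub by (cases q) (auto simp: adjacent_total_transformation)
  qed
  have "degree (total_transformation Minus Plus Plus G) (Inr e) = card e + card ?K"
    unfolding degree_eq_card_neighbours[OF finite_simple_graph_total_transformation[OF G]] nbrs
    using fin(3) e(2) by (intro card_Inl_Un_Inr) simp_all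
  \<comment> \<open>The two endpoints compensate for the 2 in \<open>count\<close>.\<close>
  also have "card e = 2"
    using e(2) uv by simp
  finally show ?thesis
    using count by (simp add: degree_def)
qed

theorem theorem6:
  fixes G :: "'a ugraph" and n m :: nat
  assumes "finite_simple_graph G"
    and "connected_graph G"
    and "card (verts G) = n"
    and "card (edges G) = m"
  shows "int (F_index (total_transformation Minus Plus Plus G)) =
    int n * (int n - 1) ^ 3 + int (xi4 G) + 3 * int (ReZG3 G)"
proof -
  note G = assms(1)
  let ?T = "total_transformation Minus Plus Plus G"
  have fin: "finite (verts G)"
    using G by (simp add: finite_simple_graph_def)
  \<comment> \<open>A connected graph has a vertex by definition, so the truncated
    \<open>n - 1\<close> on naturals agrees with \<open>int n - 1\<close> in the final
    conversion.\<close>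
  have "n > 0"
    using assms(2,3) fin by (auto simp: connected_graph_def card_gt_0_iff)
  have edge: "degree ?T (Inr e) ^ 3
      = (\<Sum>v\<in>e. degree G v ^ 3) + 3 * ((\<Prod>v\<in>e. degree G v) * (\<Sum>v\<in>e. degree G v))"
    if e: "e \<in> edges G" for e
  proof -
    obtain u v where uv: "e = {u, v}" "u \<noteq> v"
      using edgeE[OF G e] by metis
    have "degree ?T (Inr e) = degree G u + degree G v"
      using degree_transformation_edge[OF G e uv(1)] .
    \<comment> \<open>As \<open>u \<noteq> v\<close>, the sums and the product over \<open>e\<close>
      have exactly two terms, and the claim is the binomial cube.\<close>
    then show ?thesis
      using uv by (simp add: power3_eq_cube algebra_simps)
  qed
  have "F_index ?T
      = (\<Sum>v\<in>verts G. degree ?T (Inl v) ^ 3) + (\<Sum>e\<in>edges G. degree ?T (Inr e) ^ 3)"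
    using fin finite_edges[OF G]
    by (simp add: F_index_def total_transformation_def sum.Plus)
  also have "(\<Sum>v\<in>verts G. degree ?T (Inl v) ^ 3) = n * (n - 1) ^ 3"
    using assms(3) by (simp add: degree_transformation_vertex[OF G])
  \<comment> \<open>The sum of the cubes is \<open>xi4 G\<close> because each vertex contributes its
    cubed degree once per incident edge.\<close>
  also have "(\<Sum>e\<in>edges G. degree ?T (Inr e) ^ 3) = xi4 G + 3 * ReZG3 G"
    by (simp add: edge sum.distrib xi4_eq_sum_edges[OF G] ReZG3_def sum_distrib_left)
  finally show ?thesis
    using \<open>n > 0\<close> by (simp add: of_nat_diff)
qed

end
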